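(* Let $f:\mathbb{R}\to\mathbb{R}$ be continuous and differentiable, let $B:=\{(y,f(y)):y\in\mathbb{R}\}\subset\mathbb{R}^2$ and $A:=\mathbb{R}\times\{0\}$. Let $D\subset\mathbb{R}$ be nonempty and convex, and let $F:D\to\,]-\infty,+\infty]$ be convex and such that for all $y\in D$ $$\partial F(y)\supset\begin{cases}\left\{\frac{f(y)}{|y^*|^2}y^* : y^*\in\partial^0 f(y)\right\} & \text{if } 0\notin\partial^0 f(y),\\ \{0\} & \text{if } f(y)=0.\end{cases}$$ Let $V:D\times\mathbb{R}\to[-\infty,+\infty]$, $V(y,\rho):=F(y)+\tfrac12\rho^2$. Suppose further that $f'(y)\neq0$ for all $y\in D$. Let $x\in D\times\mathbb{R}$. Then the following hold. (a) If $x,P_Ax,P_BR_Ax\notin A\cap B$ are not colinear, then there exist $\mu_1,\mu_2,\mu_3\in\mathbb{R}$ such that $$C(x,R_Ax,R_BR_Ax)=P_Ax-\mu_1\nabla V(P_Ax)=P_BR_Ax-\mu_2\nabla V(P_BR_Ax)=T_{A,B}x-\mu_3\nabla V(T_{A,B}x).$$ (b) If $x,P_Bx,P_AR_Bx\notin A\cap B$ are not colinear, then there exist $\mu_1,\mu_2,\mu_3\in\mathbb{R}$ such that $$C(x,R_Bx,R_AR_Bx)=P_Bx-\mu_1\nabla V(P_Bx)=P_AR_Bx-\mu_2\nabla V(P_AR_Bx)=T_{B,A}x-\mu_3\nabla V(T_{B,A}x).$$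
   Context: For a closed set $S\subset\mathbb{R}^2$, $P_S(x)$ denotes a fixed selection of a nearest point of $S$ to $x$, $R_S:=2P_S-\mathrm{Id}$, and $T_{A,B}:=\tfrac12R_BR_A+\tfrac12\mathrm{Id}$, $T_{B,A}:=\tfrac12R_AR_B+\tfrac12\mathrm{Id}$ are the Douglas--Rachford operators. $C(a,b,c)$ is the circumcenter of $a,b,c$: the point of $\operatorname{aff}\{a,b,c\}$ equidistant from $a,b,c$ (it exists and is unique when $a,b,c$ are not colinear). $\partial^0 f(y):=\partial f(y)\cup(-\partial(-f)(y))$ is the symmetric subdifferential, where $\partial f$ is the limiting (Mordukhovich) subdifferential; $\partial F$ is the convex subdifferential of $F$; $\nabla V$ is the gradient of $V$.
   Formalization: Each of the three equations in (a) and (b) is asserted only if ∇V (taken relative to D×ℝ) exists at its point, since e.g. P_BR_Ax may lie outside D×ℝ; existence of ∇V is proved at interior points of D×ℝ and, for nondegenerate D, at endpoints y with 0∉∂⁰f(y) or f(y)=0. *)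

theory Defs
  imports "HOL-Analysis.Analysis"
begin

definition nearest_point_selection :: "'a::metric_space set \<Rightarrow> ('a \<Rightarrow> 'a) \<Rightarrow> bool" where
  "nearest_point_selection S P \<longleftrightarrow> (\<forall>x. P x \<in> S \<and> (\<forall>s\<in>S. dist x (P x) \<le> dist x s))"

definition reflector :: "('a::real_vector \<Rightarrow> 'a) \<Rightarrow> 'a \<Rightarrow> 'a" where
  "reflector P x = 2 *\<^sub>R P x - x"

text \<open>The Douglas--Rachford operator that reflects first with \<open>PA\<close> and then with \<open>PB\<close>.\<close>

definition douglas_rachford :: "('a::real_vector \<Rightarrow> 'a) \<Rightarrow> ('a \<Rightarrow> 'a) \<Rightarrow> 'a \<Rightarrow> 'a" where
  "douglas_rachford PA PB x =
     (1/2) *\<^sub>R reflector PB (reflector PA x) + (1/2) *\<^sub>R x"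

definition circumcenter :: "'a::euclidean_space \<Rightarrow> 'a \<Rightarrow> 'a \<Rightarrow> 'a" where
  "circumcenter a b c =
     (THE p. p \<in> affine hull {a, b, c} \<and> dist p a = dist p b \<and> dist p b = dist p c)"

definition frechet_subdifferential :: "('a::euclidean_space \<Rightarrow> real) \<Rightarrow> 'a \<Rightarrow> 'a set" where
  "frechet_subdifferential f x =
     {u. Liminf (at x) (\<lambda>y. ereal ((f y - f x - u \<bullet> (y - x)) / norm (y - x))) \<ge> 0}"

definition limiting_subdifferential :: "('a::euclidean_space \<Rightarrow> real) \<Rightarrow> 'a \<Rightarrow> 'a set" where
  "limiting_subdifferential f x =
     {u. \<exists>X U. X \<longlonglongrightarrow> x \<and> (\<lambda>n. f (X n)) \<longlonglongrightarrow> f x \<and> U \<longlonglongrightarrow> u \<and>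
            (\<forall>n::nat. U n \<in> frechet_subdifferential f (X n))}"

definition symmetric_subdifferential :: "('a::euclidean_space \<Rightarrow> real) \<Rightarrow> 'a \<Rightarrow> 'a set" where
  "symmetric_subdifferential f x =
     limiting_subdifferential f x \<union> uminus ` limiting_subdifferential (\<lambda>y. - f y) x"

text \<open>
  An extended-real-valued function with domain of definition \<open>S\<close> is a total function into
  \<^typ>\<open>ereal\<close> whose values outside \<open>S\<close> are never used; every notion below carries \<open>S\<close>.
\<close>

definition ereal_convex_on :: "'a::real_vector set \<Rightarrow> ('a \<Rightarrow> ereal) \<Rightarrow> bool" where
  "ereal_convex_on S F \<longleftrightarrow> convex {(x, r :: real). x \<in> S \<and> F x \<le> ereal r}"

text \<open>The convex subdifferential is empty at points where the function is not finite.\<close>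

definition convex_subdifferential ::
    "'a::real_inner set \<Rightarrow> ('a \<Rightarrow> ereal) \<Rightarrow> 'a \<Rightarrow> 'a set" where
  "convex_subdifferential S F x =
     {u. x \<in> S \<and> \<bar>F x\<bar> \<noteq> \<infinity> \<and> (\<forall>z\<in>S. F x + ereal (u \<bullet> (z - x)) \<le> F z)}"

text \<open>
  Gradients are taken relative to the domain of definition \<open>S\<close>: in the interior of \<open>S\<close> this is
  the ordinary gradient, at boundary points belonging to \<open>S\<close> only displacements that stay
  in \<open>S\<close> count. Where \<open>S\<close> is degenerate a gradient in this sense need not be unique, so
  differentiability asks for exactly one.
\<close>

definition has_gradient ::
    "('a::euclidean_space \<Rightarrow> ereal) \<Rightarrow> 'a set \<Rightarrow> 'a \<Rightarrow> 'a \<Rightarrow> bool" where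
  "has_gradient V S p g \<longleftrightarrow>
     p \<in> S \<and> \<bar>V p\<bar> \<noteq> \<infinity> \<and> (\<forall>\<^sub>F q in at p within S. \<bar>V q\<bar> \<noteq> \<infinity>) \<and>
     ((\<lambda>q. real_of_ereal (V q)) has_derivative (\<lambda>h. g \<bullet> h)) (at p within S)"

definition gradient_exists :: "('a::euclidean_space \<Rightarrow> ereal) \<Rightarrow> 'a set \<Rightarrow> 'a \<Rightarrow> bool" where
  "gradient_exists V S p \<longleftrightarrow> (\<exists>!g. has_gradient V S p g)"

definition gradient :: "('a::euclidean_space \<Rightarrow> ereal) \<Rightarrow> 'a set \<Rightarrow> 'a \<Rightarrow> 'a" where
  "gradient V S p = (THE g. has_gradient V S p g)"

end

theory Submission
  imports Defs
begin

text \<open>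
  Since \<open>f\<close> is differentiable, its symmetric subdifferential at \<open>y\<close> consists of the limits of \<open>f'\<close>
  along sequences tending to \<open>y\<close>; it contains \<open>f' y\<close>, but may contain zero because \<open>f'\<close> need not be
  continuous. Write \<open>s = f / f'\<close>. Baire's theorem shows that \<open>f'\<close> is locally bounded away from zero
  on a dense open subset of the interior of \<open>D\<close>, where therefore \<open>s y\<close> is a subgradient of \<open>F\<close>.
  Subgradients being monotone, \<open>s\<close> is locally bounded there, and a second application of Baire's
  theorem gives \<open>s y \<in> \<partial>F(y)\<close> in the whole interior. By the mean value theorem \<open>f'\<close> attains values
  close to \<open>f' y\<close> on each side of \<open>y\<close>, so monotonicity makes \<open>s\<close> continuous and \<open>F\<close> differentiable
  with derivative \<open>s\<close>. Hence wherever the gradient of \<open>V\<close> at \<open>(y, \<rho>)\<close> exists, it is \<open>(s y, \<rho>)\<close>.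

  If \<open>b\<close> is the first coordinate of the projection onto the graph, the optimality condition for that
  projection places both circumcenters at the Newton iterate \<open>(b - s b, 0)\<close>. So the steps at the graph
  point and at the Douglas--Rachford point have \<open>\<mu> = 1\<close>; at the point of \<open>A\<close> the gradient is a
  nonzero horizontal vector, which gives the remaining \<open>\<mu>\<close>.
\<close>

subsection \<open>Subdifferentials of differentiable functions of a real variable\<close>

lemma deriv_has_derivative:
  fixes f :: "real \<Rightarrow> real"
  assumes "f differentiable (at y)"
  shows "(f has_real_derivative deriv f y) (at y)"
  using assms by (metis DERIV_imp_deriv real_differentiable_def)

text \<open>Difference quotients to the right of \<open>x\<close> give u <= d and those to the left
  give d <= u, each up to an error \<open>2 * e\<close>.\<close>

lemma frechet_subdifferential_subset_deriv:
  fixes f :: "real \<Rightarrow> real"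
  assumes f: "(f has_real_derivative d) (at x)"
  shows "frechet_subdifferential f x \<subseteq> {d}"
proof
  fix u
  assume u: "u \<in> frechet_subdifferential f x"
  have lower: "eventually (\<lambda>y. - e < (f y - f x - u * (y - x)) / \<bar>y - x\<bar>) (at x)" if "e > 0" for e
  proof -
    have "ereal (- e) < 0" using that by simp
    then have "eventually (\<lambda>y. ereal (- e) < ereal ((f y - f x - u \<bullet> (y - x)) / norm (y - x))) (at x)"
      using u unfolding frechet_subdifferential_def le_Liminf_iff by blast
    then show ?thesis by simp
  qed
  have quot: "((\<lambda>y. (f y - f x) / (y - x)) \<longlongrightarrow> d) (at x)"
    using f by (simp add: has_field_derivative_iff)
  have "\<bar>u - d\<bar> < 2 * e" if e: "e > 0" for e
  proof -
    have "eventually (\<lambda>y. \<bar>(f y - f x) / (y - x) - d\<bar> < e) (at x)"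
      using tendstoD[OF quot e] by (simp add: dist_real_def)
    with lower[OF e] have "eventually (\<lambda>y. - e < (f y - f x - u * (y - x)) / \<bar>y - x\<bar> \<and>
        \<bar>(f y - f x) / (y - x) - d\<bar> < e) (at x)"
      by eventually_elim simp
    then obtain r where r: "r > 0" and near: "\<And>y. y \<noteq> x \<Longrightarrow> dist y x < r \<Longrightarrow>
        - e < (f y - f x - u * (y - x)) / \<bar>y - x\<bar> \<and> \<bar>(f y - f x) / (y - x) - d\<bar> < e"
      unfolding eventually_at by auto
    let ?q = "\<lambda>y. (f y - f x) / (y - x)"
    have "- e < ?q (x + r/2) - u" "\<bar>?q (x + r/2) - d\<bar> < e"
      using near[of "x + r/2"] r by (auto simp: dist_real_def diff_divide_distrib)
    moreover have "(f (x - r/2) - f x - u * (x - r/2 - x)) / \<bar>x - r/2 - x\<bar> = u - ?q (x - r/2)"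
      using r by (simp add: field_simps)
    then have "- e < u - ?q (x - r/2)" "\<bar>?q (x - r/2) - d\<bar> < e"
      using near[of "x - r/2"] r by (auto simp: dist_real_def)
    ultimately show ?thesis by linarith
  qed
  \<comment> \<open>If \<open>u\<close> differed from \<open>d\<close>, this choice of
    \<open>e\<close> would give |u - d| < |u - d| / 2.\<close>
  from this[of "\<bar>u - d\<bar> / 4"] show "u \<in> {d}" by fastforce
qed

lemma deriv_in_frechet_subdifferential:
  fixes f :: "real \<Rightarrow> real"
  assumes f: "(f has_real_derivative d) (at x)"
  shows "d \<in> frechet_subdifferential f x"
proof -
  have "((\<lambda>y. (f y - f x - d \<bullet> (y - x)) / norm (y - x)) \<longlongrightarrow> 0) (at x)"
    using f unfolding has_field_derivative_def has_derivative_at_within by (simp add: divide_inverse mult.commute)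
  then have "Liminf (at x) (\<lambda>y. ereal ((f y - f x - d \<bullet> (y - x)) / norm (y - x))) = ereal 0"
    by (intro lim_imp_Liminf tendsto_ereal) auto
  then show ?thesis
    by (simp add: frechet_subdifferential_def zero_ereal_def)
qed

text \<open>Constant sequences are admissible in the limiting subdifferential, so it contains the
  derivative at \<open>y\<close> even where f' is discontinuous.\<close>

lemma deriv_in_symmetric_subdifferential:
  fixes f :: "real \<Rightarrow> real"
  assumes "f differentiable (at y)"
  shows "deriv f y \<in> symmetric_subdifferential f y"
proof -
  have "deriv f y \<in> limiting_subdifferential f y"
    unfolding limiting_subdifferential_def
    using deriv_in_frechet_subdifferential[OF deriv_has_derivative[OF assms]]
    by (intro CollectI exI[of _ "\<lambda>_. y"] exI[of _ "\<lambda>_. deriv f y"]) auto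
  then show ?thesis by (simp add: symmetric_subdifferential_def)
qed

text \<open>Frechet subgradients along \<open>X\<close> are derivatives, which eventually have
  absolute value at least \<open>c\<close>, so they cannot tend to zero.\<close>

lemma zero_notin_limiting_subdifferential:
  fixes f :: "real \<Rightarrow> real"
  assumes f: "\<And>y. f differentiable (at y)"
    and bound: "open J" "z \<in> J" "c > 0" "\<And>w. w \<in> J \<Longrightarrow> c \<le> \<bar>deriv f w\<bar>"
  shows "0 \<notin> limiting_subdifferential f z"
proof
  assume "0 \<in> limiting_subdifferential f z"
  then obtain X U where X: "X \<longlonglongrightarrow> z" and U: "U \<longlonglongrightarrow> 0"
    and sub: "\<And>n. U n \<in> frechet_subdifferential f (X n)"
    unfolding limiting_subdifferential_def by blast
  have "U n = deriv f (X n)" for n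
    using frechet_subdifferential_subset_deriv[OF deriv_has_derivative[OF f]] sub by blast
  moreover have "eventually (\<lambda>n. X n \<in> J) sequentially"
    using X bound(1,2) by (rule topological_tendstoD)
  ultimately have "eventually (\<lambda>n. c \<le> \<bar>U n\<bar>) sequentially"
    using bound(4) by (auto elim: eventually_mono)
  moreover have "eventually (\<lambda>n. \<bar>U n\<bar> < c) sequentially"
    using U bound(3) by (simp add: tendsto_iff dist_real_def)
  ultimately have "eventually (\<lambda>n::nat. False) sequentially"
    by eventually_elim simp
  then show False by simp
qed

text \<open>The derivatives of f and -f have the same absolute value, so one bound serves both
  halves of the union.\<close>

lemma zero_notin_symmetric_subdifferential:
  fixes f :: "real \<Rightarrow> real"
  assumes f: "\<And>y. f differentiable (at y)"
    and bound: "open J" "z \<in> J" "c > 0" "\<And>w. w \<in> J \<Longrightarrow> c \<le> \<bar>deriv f w\<bar>"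
  shows "0 \<notin> symmetric_subdifferential f z"
proof -
  have "deriv (\<lambda>y. - f y) w = - deriv f w" for w
    by (intro DERIV_imp_deriv DERIV_minus deriv_has_derivative f)
  then have "0 \<notin> limiting_subdifferential (\<lambda>y. - f y) z"
    using bound by (intro zero_notin_limiting_subdifferential[of _ J z c]) (auto intro: differentiable_minus f)
  moreover have "0 \<notin> limiting_subdifferential f z"
    using zero_notin_limiting_subdifferential[OF f bound] .
  ultimately show ?thesis
    by (auto simp: symmetric_subdifferential_def)
qed

subsection \<open>Derivatives without zeros\<close>

text \<open>Baire category in the closed set \<open>S\<close>: countably many closed sets with
  controlled difference quotients cover \<open>S\<close>, so one of them contains a nonempty
  relatively open piece of \<open>S\<close>.\<close>

lemma derivative_bounded_below_on_portion:
  fixes f :: "real \<Rightarrow> real"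
  assumes f: "\<And>y. f differentiable (at y)" and S: "closed S" "S \<noteq> {}"
    and nz: "\<And>z. z \<in> S \<Longrightarrow> deriv f z \<noteq> 0"
  obtains J c where "open J" "S \<inter> J \<noteq> {}" "c > 0" "\<And>z. z \<in> S \<inter> J \<Longrightarrow> c \<le> \<bar>deriv f z\<bar>"
proof -
  \<comment> \<open>Difference quotients at \<open>z\<close> are at least 1 / Suc n in absolute
    value on the scale 1 / Suc n. A set described through f' itself might fail to be closed; this
    one is closed because f is continuous.\<close>
  define C where "C n = {z. \<forall>w. \<bar>w - z\<bar> < 1 / Suc n \<longrightarrow> \<bar>w - z\<bar> \<le> Suc n * \<bar>f w - f z\<bar>}" for n
  have cont: "continuous_on UNIV f"
    using f by (simp add: continuous_on_eq_continuous_at differentiable_imp_continuous_within)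
  have closed_C: "closed (C n)" for n
    unfolding C_def
    by (intro closed_Collect_all closed_Collect_imp open_Collect_less closed_Collect_le continuous_intros
        continuous_on_subset[OF cont]) auto
  have "\<exists>n. z \<in> C n" if z: "z \<in> S" for z
  proof -
    define d where "d = \<bar>deriv f z\<bar>"
    have d: "d > 0" using nz[OF z] by (simp add: d_def)
    have "((\<lambda>w. \<bar>(f w - f z) / (w - z)\<bar>) \<longlongrightarrow> d) (at z)"
      using deriv_has_derivative[OF f, of z] unfolding d_def has_field_derivative_iff by (rule tendsto_rabs)
    then have "eventually (\<lambda>w. d / 2 < \<bar>(f w - f z) / (w - z)\<bar>) (at z)"
      using d by (intro order_tendstoD(1)) auto
    then obtain r where r: "r > 0" "\<And>w. w \<noteq> z \<Longrightarrow> \<bar>w - z\<bar> < r \<Longrightarrow> d / 2 < \<bar>(f w - f z) / (w - z)\<bar>"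
      unfolding eventually_at by (auto simp: dist_real_def)
    \<comment> \<open>One index controls both the scale, which must be below \<open>r\<close>, and
      the slope, which must be below \<open>d / 2\<close>.\<close>
    obtain n where n: "1 / Suc n < min r (d / 2)"
      using r(1) d nat_approx_posE[of "min r (d / 2)"] by (metis half_gt_zero min_less_iff_conj)
    have "\<bar>w - z\<bar> \<le> Suc n * \<bar>f w - f z\<bar>" if w: "\<bar>w - z\<bar> < 1 / Suc n" for w
    proof (cases "w = z")
      case False
      have "\<bar>w - z\<bar> < r" "1 / Suc n < d / 2" using w n by auto
      with r(2)[OF False] have "1 / Suc n \<le> \<bar>(f w - f z) / (w - z)\<bar>" by linarith
      then show ?thesis using False by (simp add: field_simps)
    qed simp
    then show ?thesis unfolding C_def by blast
  qed
  then have cover: "S \<subseteq> (\<Union>n. C n)" by blast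
  \<comment> \<open>Otherwise every \<open>S - C n\<close> is relatively open and dense in
    \<open>S\<close>; by Baire so is their intersection dense, but it is empty by
    \<open>cover\<close>.\<close>
  obtain n where n: "\<not> S \<subseteq> closure (S - C n)"
  proof (rule ccontr)
    assume "\<not> thesis"
    with that have "\<And>n. S \<subseteq> closure (S - C n)" by blast
    then have "S \<subseteq> closure (\<Inter>(range (\<lambda>n. S - C n)))"
      using S(1) closed_C by (intro Baire) (auto simp: openin_open Diff_eq intro!: exI[of _ "- C _"])
    moreover have "\<Inter>(range (\<lambda>n. S - C n)) = {}" using cover by auto
    ultimately show False using S(2) by (metis closure_empty subset_empty)
  qed
  have low: "1 / Suc n \<le> \<bar>deriv f z\<bar>" if "z \<in> C n" for z
  proof -
    have "((\<lambda>w. \<bar>(f w - f z) / (w - z)\<bar>) \<longlongrightarrow> \<bar>deriv f z\<bar>) (at z)"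
      using deriv_has_derivative[OF f, of z] unfolding has_field_derivative_iff by (rule tendsto_rabs)
    moreover have "eventually (\<lambda>w. 1 / Suc n \<le> \<bar>(f w - f z) / (w - z)\<bar>) (at z)"
      unfolding eventually_at
    proof (intro exI[of _ "1 / Suc n"] conjI ballI impI)
      fix w assume w: "w \<noteq> z \<and> dist w z < 1 / Suc n"
      then have "\<bar>w - z\<bar> \<le> Suc n * \<bar>f w - f z\<bar>"
        using that by (auto simp: C_def dist_real_def)
      then show "1 / Suc n \<le> \<bar>(f w - f z) / (w - z)\<bar>"
        using w by (simp add: field_simps abs_divide)
    qed simp
    ultimately show ?thesis
      by (rule tendsto_lowerbound) simp
  qed
  \<comment> \<open>The open set is the complement of the closure of \<open>S - C n\<close>: points
    of \<open>S\<close> in it must lie in \<open>C n\<close>.\<close>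
  show thesis
  proof (rule that)
    show "open (- closure (S - C n))" by (rule open_Compl) (rule closed_closure)
    show "S \<inter> - closure (S - C n) \<noteq> {}" using n by blast
    show "(1::real) / Suc n > 0" by simp
    show "1 / Suc n \<le> \<bar>deriv f z\<bar>" if "z \<in> S \<inter> - closure (S - C n)" for z
      using that closure_subset[of "S - C n"] by (intro low) blast
  qed
qed

text \<open>A substitute for continuity of f': by the mean value theorem, difference quotients at
  \<open>y\<close> towards \<open>b\<close> are values of f' inside the segment, and they tend to
  f'(y).\<close>

lemma derivative_approached_in_segment:
  fixes f :: "real \<Rightarrow> real"
  assumes f: "\<And>y. f differentiable (at y)" and "b \<noteq> y"
  obtains \<xi> :: "nat \<Rightarrow> real" where "\<And>n. \<xi> n \<in> open_segment y b" "\<xi> \<longlonglongrightarrow> y"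
    "(\<lambda>n. deriv f (\<xi> n)) \<longlonglongrightarrow> deriv f y"
proof -
  have mvt: "\<exists>\<xi>\<in>open_segment y h. (f h - f y) / (h - y) = deriv f \<xi>" if "h \<noteq> y" for h
  proof (cases "y < h")
    case True
    then obtain \<xi> where "y < \<xi>" "\<xi> < h" "f h - f y = (h - y) * deriv f \<xi>"
      using MVT2[of y h f "deriv f"] deriv_has_derivative[OF f] by blast
    then show ?thesis using True
      by (intro bexI[of _ \<xi>]) (auto simp: open_segment_eq_real_ivl)
  next
    case False
    with that have "h < y" by simp
    then obtain \<xi> where "h < \<xi>" "\<xi> < y" "f y - f h = (y - h) * deriv f \<xi>"
      using MVT2[of h y f "deriv f"] deriv_has_derivative[OF f] by blast
    then show ?thesis using \<open>h < y\<close>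
      by (intro bexI[of _ \<xi>]) (auto simp: open_segment_eq_real_ivl field_simps)
  qed
  \<comment> \<open>Starting with parameter 1/2 instead of 1 keeps every \<open>h n\<close> strictly
    between \<open>y\<close> and \<open>b\<close>.\<close>
  define h where "h n = y + (b - y) * (1 / Suc (Suc n))" for n
  have h_ne: "h n \<noteq> y" for n using \<open>b \<noteq> y\<close> by (simp add: h_def)
  have "\<forall>n. \<exists>\<xi>. \<xi> \<in> open_segment y (h n) \<and> (f (h n) - f y) / (h n - y) = deriv f \<xi>"
    using mvt[OF h_ne] by blast
  then obtain \<xi> where \<xi>: "\<And>n. \<xi> n \<in> open_segment y (h n)"
    "\<And>n. (f (h n) - f y) / (h n - y) = deriv f (\<xi> n)"
    by metis
  have "(\<lambda>n. 1 / real (Suc (Suc n))) \<longlonglongrightarrow> 0"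
    using LIMSEQ_Suc[OF LIMSEQ_inverse_real_of_nat] by (simp add: inverse_eq_divide)
  then have "h \<longlonglongrightarrow> y + (b - y) * 0" unfolding h_def by (intro tendsto_intros)
  then have h_lim: "h \<longlonglongrightarrow> y" by simp
  have near: "\<bar>\<xi> n - y\<bar> \<le> \<bar>h n - y\<bar>" for n
    using \<xi>(1)[of n] by (auto simp: open_segment_eq_real_ivl split: if_splits)
  show thesis
  proof (rule that)
    show "\<xi> n \<in> open_segment y b" for n
    proof -
      have "h n \<in> open_segment y b"
        unfolding in_segment using \<open>b \<noteq> y\<close>
        by (intro conjI exI[of _ "1 / Suc (Suc n)"]) (auto simp: h_def algebra_simps diff_divide_distrib)
      then show ?thesis
        using \<xi>(1)[of n] by (auto simp: open_segment_eq_real_ivl split: if_splits)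
    qed
    have "(\<lambda>n. \<xi> n - y) \<longlonglongrightarrow> 0"
      by (rule tendsto_rabs_zero_cancel, rule tendsto_sandwich[of "\<lambda>_. 0" _ _ "\<lambda>n. \<bar>h n - y\<bar>"])
        (use near h_lim in \<open>auto simp: LIM_zero_iff intro!: tendsto_rabs_zero\<close>)
    then show "\<xi> \<longlonglongrightarrow> y" by (simp add: LIM_zero_iff)
    have "filterlim h (at y) sequentially"
      using h_lim h_ne by (simp add: filterlim_at)
    moreover have "((\<lambda>w. (f w - f y) / (w - y)) \<longlongrightarrow> deriv f y) (at y)"
      using deriv_has_derivative[OF f] by (simp add: has_field_derivative_iff)
    ultimately have "(\<lambda>n. (f (h n) - f y) / (h n - y)) \<longlonglongrightarrow> deriv f y"
      by (rule filterlim_compose[rotated])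
    then show "(\<lambda>n. deriv f (\<xi> n)) \<longlonglongrightarrow> deriv f y" by (simp add: \<xi>(2))
  qed
qed

subsection \<open>Convex subdifferentials\<close>

lemma convex_subdifferential_finite:
  assumes "u \<in> convex_subdifferential S F x"
  shows "x \<in> S" "F x = ereal (real_of_ereal (F x))"
  using assms by (auto simp: convex_subdifferential_def ereal_real)

lemma convex_subdifferential_real:
  assumes u: "u \<in> convex_subdifferential S F x" and z: "z \<in> S" "\<bar>F z\<bar> \<noteq> \<infinity>"
  shows "real_of_ereal (F x) + u \<bullet> (z - x) \<le> real_of_ereal (F z)"
proof -
  have "F x + ereal (u \<bullet> (z - x)) \<le> F z"
    using u z by (simp add: convex_subdifferential_def)
  then show ?thesis
    using convex_subdifferential_finite(2)[OF u] z(2)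
    by (metis ereal_less_eq(3) ereal_real' plus_ereal.simps(1))
qed

lemma convex_subdifferential_abs_finite:
  "u \<in> convex_subdifferential S F x \<Longrightarrow> \<bar>F x\<bar> \<noteq> \<infinity>"
  by (simp add: convex_subdifferential_def)

text \<open>Add the subgradient inequality at \<open>x\<close> tested at \<open>y\<close> to the one
  at \<open>y\<close> tested at \<open>x\<close>; both values of \<open>F\<close> are
  finite.\<close>

lemma convex_subdifferential_mono:
  fixes F :: "real \<Rightarrow> ereal"
  assumes u: "u \<in> convex_subdifferential S F x" and v: "v \<in> convex_subdifferential S F y"
    and "x < y"
  shows "u \<le> v"
proof -
  have "real_of_ereal (F x) + u * (y - x) \<le> real_of_ereal (F y)"
    using convex_subdifferential_real[OF u convex_subdifferential_finite(1)[OF v]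
        convex_subdifferential_abs_finite[OF v]] by simp
  moreover have "real_of_ereal (F y) + v * (x - y) \<le> real_of_ereal (F x)"
    using convex_subdifferential_real[OF v convex_subdifferential_finite(1)[OF u]
        convex_subdifferential_abs_finite[OF u]] by simp
  ultimately have "u * (y - x) \<le> v * (y - x)" by (simp add: algebra_simps)
  then show ?thesis using assms(3) by simp
qed

subsection \<open>Newton steps as subgradients\<close>

locale newton_potential =
  fixes f :: "real \<Rightarrow> real" and D :: "real set" and F :: "real \<Rightarrow> ereal"
  assumes f_diff: "\<And>y. f differentiable (at y)"
    and D_convex: "convex D"
    and f_deriv: "\<And>y. y \<in> D \<Longrightarrow> deriv f y \<noteq> 0"
    and subdiff: "\<And>y. y \<in> D \<Longrightarrow> 0 \<notin> symmetric_subdifferential f y \<Longrightarrow>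
         {(f y / \<bar>v\<bar>\<^sup>2) * v | v. v \<in> symmetric_subdifferential f y} \<subseteq> convex_subdifferential D F y"
    and subdiff_zero: "\<And>y. y \<in> D \<Longrightarrow> f y = 0 \<Longrightarrow> {0} \<subseteq> convex_subdifferential D F y"
begin

text \<open>The displacement of Newton's method, whose iterate is \<open>y - newton_step y\<close>.
  It is also the subgradient prescribed for \<open>F\<close> by the element f'(y) of the symmetric
  subdifferential.\<close>

definition newton_step :: "real \<Rightarrow> real" where
  "newton_step y = f y / deriv f y"

text \<open>The bound is demanded on a whole neighbourhood because limiting subgradients at a point
  are limits of derivatives at nearby points.\<close>

definition steep :: "real set" where
  "steep = \<Union>{J. open J \<and> (\<exists>c>0. \<forall>w\<in>J. c \<le> \<bar>deriv f w\<bar>)}"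

lemma f_continuous: "continuous_on UNIV f"
  using f_diff by (simp add: continuous_on_eq_continuous_at differentiable_imp_continuous_within)

lemma open_steep: "open steep"
  unfolding steep_def by (rule open_Union) blast

lemma steepI:
  assumes "open J" "z \<in> J" "c > 0" "\<And>w. w \<in> J \<Longrightarrow> c \<le> \<bar>deriv f w\<bar>"
  shows "z \<in> steep"
  using assms unfolding steep_def by blast

lemma newton_step_subgradient_zero:
  "y \<in> D \<Longrightarrow> f y = 0 \<Longrightarrow> newton_step y \<in> convex_subdifferential D F y"
  using subdiff_zero by (simp add: newton_step_def)

lemma newton_step_subgradient_symmetric:
  assumes "y \<in> D" "0 \<notin> symmetric_subdifferential f y"
  shows "newton_step y \<in> convex_subdifferential D F y"
proof -
  have "newton_step y = (f y / \<bar>deriv f y\<bar>\<^sup>2) * deriv f y"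
    using f_deriv[OF assms(1)] by (simp add: newton_step_def power2_eq_square)
  then show ?thesis
    using subdiff[OF assms] deriv_in_symmetric_subdifferential[OF f_diff] by blast
qed

lemma newton_step_subgradient_steep:
  assumes "y \<in> D" "y \<in> steep"
  shows "newton_step y \<in> convex_subdifferential D F y"
proof -
  obtain J c where "open J" "y \<in> J" "c > 0" "\<And>w. w \<in> J \<Longrightarrow> c \<le> \<bar>deriv f w\<bar>"
    using assms(2) unfolding steep_def by blast
  then show ?thesis
    using zero_notin_symmetric_subdifferential[OF f_diff]
    by (intro newton_step_subgradient_symmetric assms(1)) blast
qed

text \<open>A relatively open piece of an interval contains an open interval, where the Baire bound
  on f' holds on a neighbourhood of each point.\<close>

lemma steep_dense:
  assumes "a < b" "{a..b} \<subseteq> D"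
  obtains z where "z \<in> steep" "a < z" "z < b"
proof -
  obtain J c where J: "open J" "{a..b} \<inter> J \<noteq> {}" "c > 0"
    "\<And>z. z \<in> {a..b} \<inter> J \<Longrightarrow> c \<le> \<bar>deriv f z\<bar>"
  proof (rule derivative_bounded_below_on_portion[OF f_diff, of "{a..b}"])
    show "{a..b} \<noteq> {}" using assms(1) by simp
    show "deriv f z \<noteq> 0" if "z \<in> {a..b}" for z using that assms(2) f_deriv by blast
  qed auto
  \<comment> \<open>\<open>J\<close> may have been found around an endpoint; density of the open
    interval moves the point inside.\<close>
  have "closure {a<..<b} = {a..b}" using assms(1) by simp
  then have "{a<..<b} \<inter> J \<noteq> {}"
    using J(1,2) open_Int_closure_eq_empty[of J "{a<..<b}"] by (simp add: Int_commute)
  then obtain z where z: "z \<in> {a<..<b} \<inter> J" by blast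
  have "z \<in> steep"
    using J z by (intro steepI[of "{a<..<b} \<inter> J" z c]) auto
  with z that show thesis by auto
qed

lemma interior_D_interval:
  assumes "z \<in> interior D" "eventually P (nhds z)"
  obtains r where "r > 0" "{z - r..z + r} \<subseteq> D" "\<And>w. w \<in> {z - r..z + r} \<Longrightarrow> P w"
proof -
  obtain S where S: "open S" "z \<in> S" "\<And>w. w \<in> S \<Longrightarrow> P w"
    using assms(2) unfolding eventually_nhds by blast
  have "open (S \<inter> interior D)" "z \<in> S \<inter> interior D" using S assms(1) by auto
  then obtain r where r: "r > 0" "cball z r \<subseteq> S \<inter> interior D"
    using open_contains_cball by blast
  then have "{z - r..z + r} \<subseteq> S \<inter> interior D"
    by (auto simp: subset_iff dist_real_def)
  then show thesis using that r(1) S(3) interior_subset by blast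
qed

text \<open>Subgradients on either side of \<open>z\<close> bound the Newton step \<open>f / f'\<close>, hence bound \<open>f'\<close> away from
  zero at the steep points near \<open>z\<close>; a second use of Baire covers the remaining points.\<close>

lemma interior_D_steep:
  assumes z: "z \<in> interior D" and fz: "f z \<noteq> 0"
  shows "z \<in> steep"
proof (rule ccontr)
  assume nz: "z \<notin> steep"
  have "isCont f z" using f_continuous by (simp add: continuous_on_eq_continuous_at)
  then have "((\<lambda>w. \<bar>f w\<bar>) \<longlongrightarrow> \<bar>f z\<bar>) (nhds z)"
    by (intro tendsto_rabs) (simp add: continuous_at tendsto_at_iff_tendsto_nhds)
  then have "eventually (\<lambda>w. \<bar>f z\<bar> / 2 < \<bar>f w\<bar>) (nhds z)"
    using fz by (intro order_tendstoD(1)) auto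
  \<comment> \<open>Keeping |f| above |f z| / 2 turns upper bounds on the Newton step into lower
    bounds on |f'|.\<close>
  then obtain r where r: "r > 0" "{z - r..z + r} \<subseteq> D"
    and f_low: "\<And>w. w \<in> {z - r..z + r} \<Longrightarrow> \<bar>f z\<bar> / 2 < \<bar>f w\<bar>"
    using interior_D_interval[OF z] by blast
  obtain a where a: "a \<in> steep" "z - r < a" "a < z"
    using steep_dense[of "z - r" z] r by (auto simp: subset_iff)
  obtain b where b: "b \<in> steep" "z < b" "b < z + r"
    using steep_dense[of z "z + r"] r by (auto simp: subset_iff)
  have D_ab: "{a..b} \<subseteq> D" using a b r by (auto simp: subset_iff)
  \<comment> \<open>Monotonicity puts Newton steps of steep points between those at \<open>a\<close>
    and \<open>b\<close>, hence below \<open>L\<close> in absolute value; the summand 1 makes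
    \<open>L\<close> positive at once.\<close>
  define L where "L = \<bar>newton_step a\<bar> + \<bar>newton_step b\<bar> + 1"
  have L: "L > 0" by (simp add: L_def)
  have steep_low: "\<bar>f z\<bar> / 2 / L \<le> \<bar>deriv f w\<bar>" if w: "w \<in> steep" "w \<in> {a<..<b}" for w
  proof -
    have sub: "newton_step v \<in> convex_subdifferential D F v" if "v \<in> steep" "v \<in> {a..b}" for v
      using newton_step_subgradient_steep that D_ab by blast
    have "newton_step a \<le> newton_step w" "newton_step w \<le> newton_step b"
      using a b w by (auto intro!: convex_subdifferential_mono[OF sub sub])
    then have "\<bar>newton_step w\<bar> \<le> L" by (simp add: L_def)
    moreover have "\<bar>f w\<bar> = \<bar>newton_step w\<bar> * \<bar>deriv f w\<bar>"
      using f_deriv[of w] w(2) D_ab by (simp add: newton_step_def abs_divide subset_iff)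
    ultimately have "\<bar>f w\<bar> \<le> L * \<bar>deriv f w\<bar>" by (simp add: mult_right_mono)
    moreover have "\<bar>f z\<bar> / 2 < \<bar>f w\<bar>" using f_low[of w] a b w by auto
    ultimately show ?thesis using L by (simp add: field_simps)
  qed
  \<comment> \<open>Baire is now applied to the closed set of exceptional points, which contains
    \<open>z\<close>.\<close>
  let ?S = "{a..b} - steep"
  have "closed ?S" using open_steep by (simp add: closed_Diff)
  moreover have "z \<in> ?S" using nz a b by simp
  then have "?S \<noteq> {}" by blast
  ultimately obtain J c where J: "open J" "?S \<inter> J \<noteq> {}" "c > 0"
    "\<And>v. v \<in> ?S \<inter> J \<Longrightarrow> c \<le> \<bar>deriv f v\<bar>"
    using derivative_bounded_below_on_portion[OF f_diff, of ?S] f_deriv D_ab by blast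
  obtain w where w: "w \<in> ?S" "w \<in> J" using J(2) by blast
  \<comment> \<open>The endpoints were chosen steep, so they are not in the exceptional set.\<close>
  then have "w \<noteq> a" "w \<noteq> b" using a b by auto
  then have w_ab: "w \<in> {a<..<b}" using w by auto
  \<comment> \<open>Near \<open>w\<close> the steep points obey \<open>steep_low\<close> and the
    exceptional ones the bound \<open>c\<close>; the minimum works for all, contradicting the choice
    of \<open>w\<close>.\<close>
  have "w \<in> steep"
  proof (rule steepI[of "J \<inter> {a<..<b}" w "min c (\<bar>f z\<bar> / 2 / L)"])
    show "min c (\<bar>f z\<bar> / 2 / L) \<le> \<bar>deriv f v\<bar>" if "v \<in> J \<inter> {a<..<b}" for v
      using steep_low[of v] J(4)[of v] that by (cases "v \<in> steep") auto
  qed (use J w w_ab fz L in auto)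
  then show False using w by simp
qed

lemma newton_step_subgradient_interior:
  assumes "y \<in> interior D"
  shows "newton_step y \<in> convex_subdifferential D F y"
  using assms interior_subset interior_D_steep newton_step_subgradient_steep
    newton_step_subgradient_zero by blast

section \<open>Continuity of the Newton step and differentiability of \<open>F\<close>\<close>

lemma open_segment_interior:
  assumes "y \<in> D" "b \<in> D"
  shows "open_segment y b \<subseteq> interior D"
proof (rule interior_maximal)
  show "open_segment y b \<subseteq> D"
    using assms D_convex convex_contains_open_segment by blast
  show "open (open_segment y b)" by (simp add: open_segment_eq_real_ivl)
qed

lemma newton_step_approached:
  assumes y: "y \<in> D" and b: "b \<in> D" "b \<noteq> y"
  obtains \<xi> :: "nat \<Rightarrow> real" where "\<And>n. \<xi> n \<in> open_segment y b" "\<xi> \<longlonglongrightarrow> y"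
    "(\<lambda>n. newton_step (\<xi> n)) \<longlonglongrightarrow> newton_step y"
proof -
  obtain \<xi> where \<xi>: "\<And>n::nat. \<xi> n \<in> open_segment y b" "\<xi> \<longlonglongrightarrow> y"
    "(\<lambda>n. deriv f (\<xi> n)) \<longlonglongrightarrow> deriv f y"
    using derivative_approached_in_segment[OF f_diff b(2)] by blast
  have "(\<lambda>n. f (\<xi> n)) \<longlonglongrightarrow> f y"
    using f_continuous \<xi>(2) by (metis UNIV_I continuous_on_tendsto_compose eventually_sequentiallyI)
  then have "(\<lambda>n. newton_step (\<xi> n)) \<longlonglongrightarrow> newton_step y"
    unfolding newton_step_def using \<xi>(3) f_deriv[OF y] by (rule tendsto_divide)
  with \<xi> that show thesis by blast
qed

text \<open>The sign \<open>\<sigma>\<close> selects a side of \<open>y\<close>. Pick an interior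
  point \<open>\<xi> n\<close> on that side whose Newton step is within \<open>e\<close> of that at
  \<open>y\<close>; by monotonicity every point in between is at least as close.\<close>

lemma newton_step_one_sided:
  assumes y: "y \<in> D" "newton_step y \<in> convex_subdifferential D F y"
    and \<sigma>: "\<sigma> = 1 \<or> \<sigma> = -1" and "e > 0"
  obtains d where "d > 0" "\<And>z. z \<in> D \<Longrightarrow> 0 < \<sigma> * (z - y) \<Longrightarrow> \<sigma> * (z - y) < d \<Longrightarrow>
    z \<in> interior D \<and> \<bar>newton_step z - newton_step y\<bar> < e"
proof (cases "\<exists>b\<in>D. 0 < \<sigma> * (b - y)")
  case False
  then show thesis using that[of 1] by auto
next
  case True
  then obtain b where b: "b \<in> D" "0 < \<sigma> * (b - y)" by blast
  then have "b \<noteq> y" by auto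
  then obtain \<xi> where \<xi>: "\<And>n::nat. \<xi> n \<in> open_segment y b"
    "(\<lambda>n. newton_step (\<xi> n)) \<longlonglongrightarrow> newton_step y"
    using newton_step_approached[OF y(1) b(1)] by blast
  obtain n where n: "\<bar>newton_step (\<xi> n) - newton_step y\<bar> < e"
    using \<xi>(2) \<open>e > 0\<close> by (auto simp: LIMSEQ_iff)
  have \<xi>_int: "\<xi> n \<in> interior D" using \<xi>(1) open_segment_interior[OF y(1) b(1)] by blast
  note \<xi>_sub = newton_step_subgradient_interior[OF \<xi>_int]
  have \<xi>_side: "0 < \<sigma> * (\<xi> n - y)"
    using \<xi>(1)[of n] b(2) \<sigma> by (auto simp: open_segment_eq_real_ivl split: if_splits)
  show thesis
  proof (rule that[OF \<xi>_side])
    fix z assume z: "z \<in> D" "0 < \<sigma> * (z - y)" "\<sigma> * (z - y) < \<sigma> * (\<xi> n - y)"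
    have "z \<in> open_segment y (\<xi> n)"
      using z \<sigma> by (auto simp: open_segment_eq_real_ivl)
    then have z_int: "z \<in> interior D"
      using open_segment_interior[OF y(1), of "\<xi> n"] \<xi>_int interior_subset by blast
    note z_sub = newton_step_subgradient_interior[OF z_int]
    from \<sigma> have "\<bar>newton_step z - newton_step y\<bar> \<le> \<bar>newton_step (\<xi> n) - newton_step y\<bar>"
    proof
      assume "\<sigma> = 1"
      then show ?thesis
        using z convex_subdifferential_mono[OF y(2) z_sub] convex_subdifferential_mono[OF z_sub \<xi>_sub]
        by auto
    next
      assume "\<sigma> = -1"
      then show ?thesis
        using z convex_subdifferential_mono[OF z_sub y(2)] convex_subdifferential_mono[OF \<xi>_sub z_sub]
        by auto
    qed
    then show "z \<in> interior D \<and> \<bar>newton_step z - newton_step y\<bar> < e" using z_int n by simp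
  qed
qed

lemma newton_step_continuous_within:
  assumes y: "y \<in> D" "newton_step y \<in> convex_subdifferential D F y" and "e > 0"
  shows "eventually (\<lambda>z. z \<in> interior D \<and> \<bar>newton_step z - newton_step y\<bar> < e) (at y within D)"
proof -
  obtain d1 where d1: "d1 > 0" "\<And>z. z \<in> D \<Longrightarrow> 0 < z - y \<Longrightarrow> z - y < d1 \<Longrightarrow>
    z \<in> interior D \<and> \<bar>newton_step z - newton_step y\<bar> < e"
    using newton_step_one_sided[OF y, of 1 e] \<open>e > 0\<close> by auto
  obtain d2 where d2: "d2 > 0" "\<And>z. z \<in> D \<Longrightarrow> 0 < y - z \<Longrightarrow> y - z < d2 \<Longrightarrow>
    z \<in> interior D \<and> \<bar>newton_step z - newton_step y\<bar> < e"
    using newton_step_one_sided[OF y, of "-1" e] \<open>e > 0\<close> by auto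
  show ?thesis
    unfolding eventually_at
  proof (intro exI[of _ "min d1 d2"] conjI ballI impI)
    fix z assume "z \<in> D" "z \<noteq> y \<and> dist z y < min d1 d2"
    then show "z \<in> interior D" "\<bar>newton_step z - newton_step y\<bar> < e"
      using d1(2)[of z] d2(2)[of z] by (cases "y < z"; auto simp: dist_real_def)+
  qed (use d1 d2 in simp)
qed

lemma F_finite_near:
  assumes "y \<in> D" "newton_step y \<in> convex_subdifferential D F y"
  shows "eventually (\<lambda>z. \<bar>F z\<bar> \<noteq> \<infinity>) (at y within D)"
  using newton_step_continuous_within[OF assms zero_less_one]
  by eventually_elim (meson convex_subdifferential_abs_finite newton_step_subgradient_interior)

text \<open>The subgradient inequalities at \<open>y\<close> and \<open>z\<close> squeeze the
  difference quotient between the Newton steps at \<open>y\<close> and \<open>z\<close>, and the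
  latter tends to the former.\<close>

lemma F_has_derivative:
  assumes y: "y \<in> D" "newton_step y \<in> convex_subdifferential D F y"
  shows "((\<lambda>z. real_of_ereal (F z)) has_real_derivative newton_step y) (at y within D)"
  unfolding has_field_derivative_iff
proof (rule tendstoI)
  fix e :: real assume "e > 0"
  let ?\<phi> = "\<lambda>z. real_of_ereal (F z)"
  have "eventually (\<lambda>z. z \<noteq> y) (at y within D)" by (simp add: eventually_at_filter)
  with newton_step_continuous_within[OF y \<open>e > 0\<close>]
  show "eventually (\<lambda>z. dist ((?\<phi> z - ?\<phi> y) / (z - y)) (newton_step y) < e) (at y within D)"
  proof eventually_elim
    case (elim z)
    then have z_sub: "newton_step z \<in> convex_subdifferential D F z"
      using newton_step_subgradient_interior by blast
    have lo: "newton_step y * (z - y) \<le> ?\<phi> z - ?\<phi> y"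
      using convex_subdifferential_real[OF y(2) convex_subdifferential_finite(1)[OF z_sub]
          convex_subdifferential_abs_finite[OF z_sub]] by simp
    have hi: "?\<phi> z - ?\<phi> y \<le> newton_step z * (z - y)"
      using convex_subdifferential_real[OF z_sub convex_subdifferential_finite(1)[OF y(2)]
          convex_subdifferential_abs_finite[OF y(2)]] by (simp add: algebra_simps)
    have "\<bar>(?\<phi> z - ?\<phi> y) / (z - y) - newton_step y\<bar> \<le> \<bar>newton_step z - newton_step y\<bar>"
    proof (cases "y < z")
      case True
      then have "newton_step y \<le> (?\<phi> z - ?\<phi> y) / (z - y)" "(?\<phi> z - ?\<phi> y) / (z - y) \<le> newton_step z"
        using lo hi by (simp_all add: pos_le_divide_eq pos_divide_le_eq)
      then show ?thesis by linarith
    next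
      case False
      with elim have "z < y" by simp
      then have "newton_step z \<le> (?\<phi> z - ?\<phi> y) / (z - y)" "(?\<phi> z - ?\<phi> y) / (z - y) \<le> newton_step y"
        using lo hi by (simp_all add: neg_le_divide_eq neg_divide_le_eq)
      then show ?thesis by linarith
    qed
    then show ?case using elim by (simp add: dist_real_def)
  qed
qed

text \<open>The graph of a subdifferential is closed, and \<open>newton_step\<close> has a limit along a sequence.\<close>

lemma newton_step_subgradient_of_continuous:
  assumes y: "y \<in> D" "\<bar>F y\<bar> \<noteq> \<infinity>" and b: "b \<in> D" "b \<noteq> y"
    and cont: "((\<lambda>z. real_of_ereal (F z)) \<longlongrightarrow> real_of_ereal (F y)) (at y within D)"
  shows "newton_step y \<in> convex_subdifferential D F y"
proof -
  obtain \<xi> where \<xi>: "\<And>n::nat. \<xi> n \<in> open_segment y b" "\<xi> \<longlonglongrightarrow> y"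
    "(\<lambda>n. newton_step (\<xi> n)) \<longlonglongrightarrow> newton_step y"
    using newton_step_approached[OF y(1) b] by blast
  have sub: "newton_step (\<xi> n) \<in> convex_subdifferential D F (\<xi> n)" for n
    using \<xi>(1) open_segment_interior[OF y(1) b(1)] newton_step_subgradient_interior by blast
  have "\<xi> n \<noteq> y" for n using \<xi>(1)[of n] by (auto simp: open_segment_def)
  then have "filterlim \<xi> (at y within D) sequentially"
    using \<xi>(2) convex_subdifferential_finite(1)[OF sub] by (simp add: filterlim_at)
  then have F_lim: "(\<lambda>n. real_of_ereal (F (\<xi> n))) \<longlonglongrightarrow> real_of_ereal (F y)"
    by (rule filterlim_compose[OF cont])
  have "F y + ereal (newton_step y * (z - y)) \<le> F z" if z: "z \<in> D" for z
  proof (cases "\<bar>F z\<bar> = \<infinity>")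
    \<comment> \<open>The finite subgradient inequality at \<open>\<xi> 0\<close> excludes minus
      infinity, so \<open>F z\<close> is plus infinity and the claim is trivial.\<close>
    case True
    have "F (\<xi> 0) + ereal (newton_step (\<xi> 0) * (z - \<xi> 0)) \<le> F z"
      using sub[of 0] z by (simp add: convex_subdifferential_def)
    then have "F z \<noteq> - \<infinity>"
      using convex_subdifferential_finite(2)[OF sub, of 0] by (cases "F (\<xi> 0)") auto
    with True show ?thesis by auto
  next
    case False
    have "(\<lambda>n. real_of_ereal (F (\<xi> n)) + newton_step (\<xi> n) * (z - \<xi> n))
        \<longlonglongrightarrow> real_of_ereal (F y) + newton_step y * (z - y)"
      by (intro tendsto_intros F_lim \<xi>)
    then have "real_of_ereal (F y) + newton_step y * (z - y) \<le> real_of_ereal (F z)"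
      using convex_subdifferential_real[OF sub z False] by (intro LIMSEQ_le_const2) auto
    then show ?thesis using False y(2)
      by (metis ereal_less_eq(3) ereal_real' plus_ereal.simps(1))
  qed
  then show ?thesis using y by (simp add: convex_subdifferential_def)
qed

end

subsection \<open>The gradient of the Lyapunov function\<close>

text \<open>The domain contains arbitrarily small displacements along both axes: horizontally
  towards \<open>b\<close> by convexity, vertically without restriction.\<close>

lemma has_gradient_unique:
  assumes D: "convex D" "y \<in> D" "b \<in> D" "b \<noteq> y"
    and g: "has_gradient V (D \<times> UNIV) (y, \<rho>) g" and g': "has_gradient V (D \<times> UNIV) (y, \<rho>) g'"
  shows "g = (g' :: real \<times> real)"
proof -
  have "(\<lambda>h. g \<bullet> h) = (\<lambda>h. g' \<bullet> h)"
  proof (rule frechet_derivative_unique_within)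
    fix i :: "real \<times> real" and e :: real
    assume i: "i \<in> Basis" and e: "e > 0"
    then consider "i = (1, 0)" | "i = (0, 1)" by (auto simp: Basis_prod_def)
    then show "\<exists>d. 0 < \<bar>d\<bar> \<and> \<bar>d\<bar> < e \<and> (y, \<rho>) + d *\<^sub>R i \<in> D \<times> UNIV"
    proof cases
      case 1
      \<comment> \<open>The cap 1 keeps the point on the segment from \<open>y\<close> to
        \<open>b\<close>; the other bound makes the displacement at most e / 2.\<close>
      define t where "t = min 1 (e / (2 * \<bar>b - y\<bar>))"
      have t: "0 < t" "t \<le> 1" using e D(4) by (auto simp: t_def)
      have "t * \<bar>b - y\<bar> \<le> e / (2 * \<bar>b - y\<bar>) * \<bar>b - y\<bar>"
        by (intro mult_right_mono) (auto simp: t_def)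
      also have "\<dots> < e" using e D(4) by simp
      finally have "\<bar>t * (b - y)\<bar> < e" using t by (simp add: abs_mult)
      moreover have "(1 - t) *\<^sub>R y + t *\<^sub>R b \<in> D"
        using t D by (intro convexD_alt) auto
      then have "y + t * (b - y) \<in> D" by (simp add: algebra_simps)
      ultimately show ?thesis
        using 1 t D(4) by (intro exI[of _ "t * (b - y)"]) auto
    next
      case 2
      then show ?thesis using e D(2) by (intro exI[of _ "e / 2"]) auto
    qed
  qed (use g g' in \<open>auto simp: has_gradient_def\<close>)
  then show ?thesis by (metis vector_eq_rdot)
qed

text \<open>If \<open>D\<close> had only the point \<open>y\<close>, the function
  \<open>fst q - y\<close> would vanish on the domain; adding it to \<open>V\<close> shows that
  \<open>g + (1, 0)\<close> is a gradient too, against uniqueness.\<close>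

lemma gradient_exists_nontrivial:
  assumes "gradient_exists V (D \<times> UNIV) (y, \<rho>)"
  obtains b :: real where "b \<in> D" "b \<noteq> y"
proof (rule ccontr)
  assume "\<not> thesis"
  with that have D: "D \<subseteq> {y}" by blast
  obtain g where g: "has_gradient V (D \<times> UNIV) (y, \<rho>) g"
    using assms unfolding gradient_exists_def by blast
  let ?v = "\<lambda>q. real_of_ereal (V q)"
  have "(?v has_derivative (\<lambda>h. g \<bullet> h)) (at (y, \<rho>) within D \<times> UNIV)"
    using g by (simp add: has_gradient_def)
  then have "((\<lambda>q. ?v q + (fst q - y)) has_derivative (\<lambda>h. (g + (1, 0)) \<bullet> h)) (at (y, \<rho>) within D \<times> UNIV)"
    by (auto intro!: derivative_eq_intros simp: inner_prod_def fun_eq_iff algebra_simps)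
  then have "(?v has_derivative (\<lambda>h. (g + (1, 0)) \<bullet> h)) (at (y, \<rho>) within D \<times> UNIV)"
    by (rule has_derivative_transform[rotated 2]) (use g D in \<open>auto simp: has_gradient_def\<close>)
  then have "has_gradient V (D \<times> UNIV) (y, \<rho>) (g + (1, 0))"
    using g by (simp add: has_gradient_def)
  then have "g + (1, 0) = g"
    using assms g unfolding gradient_exists_def by blast
  then show False by (simp add: prod_eq_iff)
qed

context newton_potential
begin

text \<open>\<open>V\<close> is a sum of functions of separate coordinates. Finiteness of
  \<open>F\<close> near \<open>y\<close> lets the real parts be added.\<close>

lemma has_gradient_newton:
  assumes V: "\<And>y \<rho>. y \<in> D \<Longrightarrow> V (y, \<rho>) = F y + ereal (1/2 * \<rho>\<^sup>2)"
    and y: "y \<in> D" "newton_step y \<in> convex_subdifferential D F y"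
  shows "has_gradient V (D \<times> UNIV) (y, \<rho>) (newton_step y, \<rho>)"
proof -
  have V_finite: "\<bar>V (z, r)\<bar> \<noteq> \<infinity> \<longleftrightarrow> \<bar>F z\<bar> \<noteq> \<infinity>" if "z \<in> D" for z r
    unfolding V[OF that] by (cases "F z") auto
  have F_fin: "\<bar>F y\<bar> \<noteq> \<infinity>" using convex_subdifferential_abs_finite[OF y(2)] .
  obtain d where d: "d > 0" "\<And>z. z \<in> D \<Longrightarrow> z \<noteq> y \<Longrightarrow> dist z y < d \<Longrightarrow> \<bar>F z\<bar> \<noteq> \<infinity>"
    using F_finite_near[OF y] unfolding eventually_at by metis
  have V_near: "\<bar>V q\<bar> \<noteq> \<infinity>" if q: "q \<in> D \<times> UNIV" "dist q (y, \<rho>) < d" for q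
  proof -
    have "dist (fst q) y < d" using dist_fst_le[of q "(y, \<rho>)"] q(2) by simp
    moreover have "fst q \<in> D" using q(1) by auto
    ultimately have "\<bar>F (fst q)\<bar> \<noteq> \<infinity>" using d(2)[of "fst q"] F_fin by (cases "fst q = y") simp_all
    then show ?thesis using V_finite[of "fst q" "snd q"] q(1) by auto
  qed
  let ?W = "\<lambda>q. real_of_ereal (F (fst q)) + 1/2 * (snd q)\<^sup>2"
  have "((\<lambda>q. real_of_ereal (F (fst q))) has_derivative (\<lambda>h. newton_step y * fst h))
      (at (y, \<rho>) within D \<times> UNIV)"
    using F_has_derivative[OF y]
    by (intro has_derivative_in_compose[where f = fst and g = "\<lambda>z. real_of_ereal (F z)"]
        has_derivative_fst has_derivative_ident)
      (simp add: has_field_derivative_def)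
  then have W_deriv: "(?W has_derivative (\<lambda>h. (newton_step y, \<rho>) \<bullet> h)) (at (y, \<rho>) within D \<times> UNIV)"
    by (auto intro!: derivative_eq_intros simp: inner_prod_def)
  have "((\<lambda>q. real_of_ereal (V q)) has_derivative (\<lambda>h. (newton_step y, \<rho>) \<bullet> h)) (at (y, \<rho>) within D \<times> UNIV)"
  proof (rule has_derivative_transform_within[OF W_deriv d(1)])
    show "?W q = real_of_ereal (V q)" if "q \<in> D \<times> UNIV" "dist q (y, \<rho>) < d" for q
    proof -
      have "\<bar>F (fst q)\<bar> \<noteq> \<infinity>"
        using V_near[OF that] V_finite[of "fst q" "snd q"] that(1) by auto
      then show ?thesis using V[of "fst q" "snd q"] that(1) by (cases "F (fst q)") auto
    qed
  qed (use y in auto)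
  moreover have "eventually (\<lambda>q. \<bar>V q\<bar> \<noteq> \<infinity>) (at (y, \<rho>) within D \<times> UNIV)"
    unfolding eventually_at using d(1) V_near by (intro exI[of _ d]) simp
  moreover have "(y, \<rho>) \<in> D \<times> UNIV" "\<bar>V (y, \<rho>)\<bar> \<noteq> \<infinity>"
    using y(1) F_fin V_finite[OF y(1)] by simp_all
  ultimately show ?thesis
    unfolding has_gradient_def by (intro conjI)
qed

lemma gradient_exists_newton:
  assumes V: "\<And>y \<rho>. y \<in> D \<Longrightarrow> V (y, \<rho>) = F y + ereal (1/2 * \<rho>\<^sup>2)"
    and y: "y \<in> D" "newton_step y \<in> convex_subdifferential D F y" and b: "b \<in> D" "b \<noteq> y"
  shows "gradient_exists V (D \<times> UNIV) (y, \<rho>)"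
  unfolding gradient_exists_def
  using has_gradient_newton[OF V y] has_gradient_unique[OF D_convex y(1) b] by blast

text \<open>Differentiability of \<open>V\<close> makes \<open>F\<close> continuous along the
  horizontal slice, so the closed graph of the subdifferential applies. This handles boundary points
  of \<open>D\<close> too.\<close>

lemma has_gradient_subgradient:
  assumes V: "\<And>y \<rho>. y \<in> D \<Longrightarrow> V (y, \<rho>) = F y + ereal (1/2 * \<rho>\<^sup>2)"
    and g: "has_gradient V (D \<times> UNIV) (y, \<rho>) g" and b: "b \<in> D" "b \<noteq> y"
  shows "newton_step y \<in> convex_subdifferential D F y"
proof (rule newton_step_subgradient_of_continuous[OF _ _ b])
  show y: "y \<in> D" using g by (auto simp: has_gradient_def)
  have V_fin: "\<bar>V (y, \<rho>)\<bar> \<noteq> \<infinity>" and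
    V_near: "eventually (\<lambda>q. \<bar>V q\<bar> \<noteq> \<infinity>) (at (y, \<rho>) within D \<times> UNIV)" and
    V_deriv: "((\<lambda>q. real_of_ereal (V q)) has_derivative (\<lambda>h. g \<bullet> h)) (at (y, \<rho>) within D \<times> UNIV)"
    using g by (auto simp: has_gradient_def)
  show "\<bar>F y\<bar> \<noteq> \<infinity>" using V_fin unfolding V[OF y] by (cases "F y") auto
  have slice: "filterlim (\<lambda>z. (z, \<rho>)) (at (y, \<rho>) within D \<times> UNIV) (at y within D)"
    unfolding filterlim_at by (auto intro!: tendsto_intros simp: eventually_at_filter)
  have V_real: "real_of_ereal (V (z, \<rho>)) = real_of_ereal (F z) + 1/2 * \<rho>\<^sup>2"
    if "z \<in> D" "\<bar>V (z, \<rho>)\<bar> \<noteq> \<infinity>" for z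
    using that(2) unfolding V[OF that(1)] by (cases "F z") auto
  have "((\<lambda>q. real_of_ereal (V q)) \<longlongrightarrow> real_of_ereal (V (y, \<rho>))) (at (y, \<rho>) within D \<times> UNIV)"
    using has_derivative_continuous[OF V_deriv] by (simp add: continuous_within)
  from filterlim_compose[OF this slice]
  have "((\<lambda>z. real_of_ereal (V (z, \<rho>)) - 1/2 * \<rho>\<^sup>2) \<longlongrightarrow> real_of_ereal (V (y, \<rho>)) - 1/2 * \<rho>\<^sup>2) (at y within D)"
    by (rule tendsto_diff[OF _ tendsto_const])
  moreover have "eventually (\<lambda>z. z \<in> D) (at y within D)" by (simp add: eventually_at_filter)
  with eventually_compose_filterlim[OF V_near slice]
  have "eventually (\<lambda>z. real_of_ereal (V (z, \<rho>)) - 1/2 * \<rho>\<^sup>2 = real_of_ereal (F z)) (at y within D)"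
    by eventually_elim (simp add: V_real)
  ultimately show "((\<lambda>z. real_of_ereal (F z)) \<longlongrightarrow> real_of_ereal (F y)) (at y within D)"
    using V_real[OF y V_fin] by (simp add: tendsto_cong)
qed

lemma gradient_newton:
  assumes V: "\<And>y \<rho>. y \<in> D \<Longrightarrow> V (y, \<rho>) = F y + ereal (1/2 * \<rho>\<^sup>2)"
    and ex: "gradient_exists V (D \<times> UNIV) (y, \<rho>)"
  shows "y \<in> D" "gradient V (D \<times> UNIV) (y, \<rho>) = (newton_step y, \<rho>)"
proof -
  obtain b where b: "b \<in> D" "b \<noteq> y" using gradient_exists_nontrivial[OF ex] by blast
  obtain g where g: "has_gradient V (D \<times> UNIV) (y, \<rho>) g"
    using ex unfolding gradient_exists_def by blast
  then show y: "y \<in> D" by (auto simp: has_gradient_def)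
  have "has_gradient V (D \<times> UNIV) (y, \<rho>) (newton_step y, \<rho>)"
    using has_gradient_newton[OF V y has_gradient_subgradient[OF V g b]] .
  then show "gradient V (D \<times> UNIV) (y, \<rho>) = (newton_step y, \<rho>)"
    using ex unfolding gradient_def gradient_exists_def by (rule the1_equality[rotated])
qed

end

subsection \<open>Circumcenters and projections in the plane\<close>

lemma collinearI:
  fixes u :: "'a::real_vector"
  assumes "\<And>x y. x \<in> S \<Longrightarrow> y \<in> S \<Longrightarrow> \<exists>c. x - y = c *\<^sub>R u"
  shows "collinear S"
  using assms unfolding collinear_def by blast

text \<open>The difference of two candidates is orthogonal to a - b and c - b but also lies in their
  span, so it vanishes.\<close>

lemma circumcenter_eqI:
  fixes a b c p :: "'a::euclidean_space"
  assumes p: "p \<in> affine hull {a, b, c}" "dist p a = dist p b" "dist p b = dist p c"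
  shows "circumcenter a b c = p"
  unfolding circumcenter_def
proof (rule the_equality)
  show "p \<in> affine hull {a, b, c} \<and> dist p a = dist p b \<and> dist p b = dist p c"
    using p by blast
next
  fix q
  assume q: "q \<in> affine hull {a, b, c} \<and> dist q a = dist q b \<and> dist q b = dist q c"
  have orth: "(p - q) \<bullet> (u - v) = 0" if "dist p u = dist p v" "dist q u = dist q v" for u v
  proof -
    have "(p - u) \<bullet> (p - u) = (p - v) \<bullet> (p - v)" "(q - u) \<bullet> (q - u) = (q - v) \<bullet> (q - v)"
      using that by (simp_all add: dist_norm norm_eq)
    then show ?thesis by (simp add: inner_diff_left inner_diff_right inner_commute)
  qed
  have coords: "\<exists>u w. z = b + u *\<^sub>R (a - b) + w *\<^sub>R (c - b)" if z: "z \<in> affine hull {a, b, c}" for z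
  proof -
    obtain u v w where "z = u *\<^sub>R a + v *\<^sub>R b + w *\<^sub>R c" "u + v + w = 1"
      using z by (auto simp: affine_hull_3)
    moreover from this have "v = 1 - u - w" by simp
    ultimately show ?thesis
      by (intro exI[of _ u] exI[of _ w]) (simp add: algebra_simps)
  qed
  obtain u w where pc: "p = b + u *\<^sub>R (a - b) + w *\<^sub>R (c - b)" using coords[OF p(1)] by blast
  obtain u' w' where qc: "q = b + u' *\<^sub>R (a - b) + w' *\<^sub>R (c - b)" using coords q by blast
  have "p - q = (u - u') *\<^sub>R (a - b) + (w - w') *\<^sub>R (c - b)"
    unfolding pc qc by (simp add: scaleR_diff_left)
  then have "(p - q) \<bullet> (p - q) = (p - q) \<bullet> ((u - u') *\<^sub>R (a - b) + (w - w') *\<^sub>R (c - b))"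
    by simp
  also have "\<dots> = 0"
    using orth[of a b] orth[of c b] p q by (simp add: inner_add_right)
  finally show "q = p" by simp
qed

lemma axis_in_affine_hull:
  fixes r s :: real
  assumes "fst z \<noteq> r" "s \<noteq> 0"
  shows "(c, 0) \<in> affine hull {(r, s), (r, - s), z}"
proof -
  \<comment> \<open>The weight \<open>w\<close> of \<open>z\<close> fixes the first coordinate;
    \<open>k\<close> splits the remaining weight between the mirror points so that the second
    coordinate cancels.\<close>
  define w where "w = (c - r) / (fst z - r)"
  define k where "k = - w * snd z / s"
  have "(c, 0) = ((1 - w + k) / 2) *\<^sub>R (r, s) + ((1 - w - k) / 2) *\<^sub>R (r, - s) + w *\<^sub>R z"
  proof (rule prod_eqI)
    have "w * (fst z - r) = c - r" using assms(1) by (simp add: w_def)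
    then show "fst (c, 0) = fst (((1 - w + k) / 2) *\<^sub>R (r, s) + ((1 - w - k) / 2) *\<^sub>R (r, - s) + w *\<^sub>R z)"
      by (simp add: algebra_simps add_divide_distrib diff_divide_distrib)
    have "k * s = - w * snd z" using assms(2) by (simp add: k_def)
    then show "snd (c, 0) = snd (((1 - w + k) / 2) *\<^sub>R (r, s) + ((1 - w - k) / 2) *\<^sub>R (r, - s) + w *\<^sub>R z)"
      by (simp add: algebra_simps add_divide_distrib diff_divide_distrib)
  qed
  moreover have "(1 - w + k) / 2 + (1 - w - k) / 2 + w = 1" by (simp add: field_simps)
  ultimately show ?thesis unfolding affine_hull_3 by blast
qed

lemma dist_prod_eq_iff:
  fixes p q r s :: "real \<times> real"
  shows "dist p q = dist r s \<longleftrightarrow>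
    (fst p - fst q)\<^sup>2 + (snd p - snd q)\<^sup>2 = (fst r - fst s)\<^sup>2 + (snd r - snd s)\<^sup>2"
  by (simp add: dist_prod_def dist_real_def)

lemma nearest_point_axis:
  fixes x :: "real \<times> real"
  assumes "nearest_point_selection (UNIV \<times> {0}) P"
  shows "P x = (fst x, 0)"
proof -
  have "P x \<in> UNIV \<times> {0}" and nearest: "dist x (P x) \<le> dist x (fst x, 0)"
    using assms unfolding nearest_point_selection_def by blast+
  then have "snd (P x) = 0" by auto
  with nearest have "(fst x - fst (P x))\<^sup>2 \<le> 0"
    by (simp add: dist_prod_def dist_real_def del: real_sqrt_abs)
  then show ?thesis using \<open>snd (P x) = 0\<close> by (simp add: prod_eq_iff)
qed

text \<open>The equation is the first-order condition for minimizing the squared distance from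
  \<open>x\<close> to the graph: \<open>x - P x\<close> is normal to the graph.\<close>

lemma nearest_point_graph:
  fixes f :: "real \<Rightarrow> real" and x :: "real \<times> real"
  assumes P: "nearest_point_selection {(y, f y) | y. y \<in> UNIV} P"
    and f: "\<And>y. f differentiable (at y)"
  obtains b where "P x = (b, f b)" "fst x - b + (snd x - f b) * deriv f b = 0"
proof -
  have "P x \<in> {(y, f y) | y. y \<in> UNIV}"
    and nearest: "\<And>s. s \<in> {(y, f y) | y. y \<in> UNIV} \<Longrightarrow> dist x (P x) \<le> dist x s"
    using P unfolding nearest_point_selection_def by blast+
  then obtain b where b: "P x = (b, f b)" by blast
  let ?g = "\<lambda>w. (fst x - w)\<^sup>2 + (snd x - f w)\<^sup>2"
  have "?g b \<le> ?g w" for w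
    using nearest[of "(w, f w)"] by (simp add: b dist_prod_def dist_real_def)
  moreover have "(?g has_real_derivative - 2 * (fst x - b + (snd x - f b) * deriv f b)) (at b)"
    by (auto intro!: derivative_eq_intros deriv_has_derivative f simp: algebra_simps)
  ultimately have "- 2 * (fst x - b + (snd x - f b) * deriv f b) = 0"
    by (intro DERIV_local_min[of ?g _ b 1]) auto
  with b that show thesis by simp
qed

text \<open>Here \<open>\<phi>\<close> and \<open>m\<close> stand for f(b) and f'(b). The first two
  points are mirror images, so the center lies on the axis. The last two have midpoint (b, \<phi>)
  and differ by a normal of the graph, so their bisector is the tangent. Tangent and axis meet at
  the Newton iterate.\<close>

lemma circumcenter_axis_graph:
  fixes x1 x2 b m \<phi> :: real
  assumes "x2 \<noteq> 0" "b \<noteq> x1" "x1 - b + (- x2 - \<phi>) * m = 0"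
  shows "circumcenter (x1, x2) (x1, - x2) (2 * b - x1, 2 * \<phi> + x2) = (b - \<phi> / m, 0)"
proof (rule circumcenter_eqI)
  show "(b - \<phi> / m, 0) \<in> affine hull {(x1, x2), (x1, - x2), (2 * b - x1, 2 * \<phi> + x2)}"
    using assms by (intro axis_in_affine_hull) auto
  show "dist (b - \<phi> / m, 0) (x1, x2) = dist (b - \<phi> / m, 0) (x1, - x2)"
    by (simp add: dist_prod_eq_iff)
  \<comment> \<open>A zero slope would force b = x1 in the optimality condition.\<close>
  have "m \<noteq> 0" using assms by auto
  then have m: "(\<phi> / m) * m = \<phi>" by simp
  define c where "c = \<phi> / m"
  \<comment> \<open>Eliminating \<open>x1\<close> and then \<open>\<phi>\<close> turns equality of
    distances into a polynomial identity.\<close>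
  have x1: "x1 = b + (x2 + \<phi>) * m" using assms(3) by (simp add: algebra_simps)
  have \<phi>: "\<phi> = c * m" using m by (simp add: c_def)
  show "dist (b - \<phi> / m, 0) (x1, - x2) = dist (b - \<phi> / m, 0) (2 * b - x1, 2 * \<phi> + x2)"
    unfolding dist_prod_eq_iff c_def[symmetric] fst_conv snd_conv x1 unfolding \<phi>
    by (simp add: power2_eq_square algebra_simps)
qed

text \<open>The same picture with the reflections exchanged: the tangent bisects the first two
  points and the axis the last two.\<close>

lemma circumcenter_graph_axis:
  fixes x1 x2 b m \<phi> :: real
  assumes "b \<noteq> x1" "2 * \<phi> - x2 \<noteq> 0" "x1 - b + (x2 - \<phi>) * m = 0"
  shows "circumcenter (x1, x2) (2 * b - x1, 2 * \<phi> - x2) (2 * b - x1, x2 - 2 * \<phi>) = (b - \<phi> / m, 0)"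
proof (rule circumcenter_eqI)
  have "(b - \<phi> / m, 0) \<in> affine hull
      {(2 * b - x1, 2 * \<phi> - x2), (2 * b - x1, - (2 * \<phi> - x2)), (x1, x2)}"
    using assms by (intro axis_in_affine_hull) auto
  then show "(b - \<phi> / m, 0) \<in> affine hull {(x1, x2), (2 * b - x1, 2 * \<phi> - x2), (2 * b - x1, x2 - 2 * \<phi>)}"
    by (simp add: insert_commute)
  show "dist (b - \<phi> / m, 0) (2 * b - x1, 2 * \<phi> - x2) = dist (b - \<phi> / m, 0) (2 * b - x1, x2 - 2 * \<phi>)"
    by (simp add: dist_prod_eq_iff power2_commute)
  have "m \<noteq> 0" using assms by auto
  then have m: "(\<phi> / m) * m = \<phi>" by simp
  define c where "c = \<phi> / m"
  have x1: "x1 = b - (x2 - \<phi>) * m" using assms(3) by (simp add: algebra_simps)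
  have \<phi>: "\<phi> = c * m" using m by (simp add: c_def)
  show "dist (b - \<phi> / m, 0) (x1, x2) = dist (b - \<phi> / m, 0) (2 * b - x1, 2 * \<phi> - x2)"
    unfolding dist_prod_eq_iff c_def[symmetric] fst_conv snd_conv x1 unfolding \<phi>
    by (simp add: power2_eq_square algebra_simps)
qed

text \<open>The points involved may leave the domain of \<open>V\<close> or lie over boundary points
  of \<open>D\<close> where the subgradient hypotheses say nothing. Each identity is therefore
  conditional on existence of the gradient, and the first conjunct tells where existence is
  guaranteed.\<close>

theorem corollary1:
  fixes f :: "real \<Rightarrow> real"
    and A B :: "(real \<times> real) set"
    and PA PB :: "real \<times> real \<Rightarrow> real \<times> real"
    and D :: "real set"
    and F :: "real \<Rightarrow> ereal"
    and V :: "real \<times> real \<Rightarrow> ereal"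
    and x :: "real \<times> real"
  assumes f_cont: "continuous_on UNIV f"
    and f_diff: "\<And>y. f differentiable (at y)"
    and B: "B = {(y, f y) | y. y \<in> UNIV}"
    and A: "A = UNIV \<times> {0}"
    and PA: "nearest_point_selection A PA"
    and PB: "nearest_point_selection B PB"
    and D: "D \<noteq> {}" "convex D"
    and F_range: "\<And>y. y \<in> D \<Longrightarrow> F y \<noteq> -\<infinity>"
    and F_convex: "ereal_convex_on D F"
    and F_subdiff:
      "\<And>y. y \<in> D \<Longrightarrow> 0 \<notin> symmetric_subdifferential f y \<Longrightarrow>
         {(f y / \<bar>v\<bar>\<^sup>2) * v | v. v \<in> symmetric_subdifferential f y} \<subseteq> convex_subdifferential D F y"
    and F_subdiff_zero:
      "\<And>y. y \<in> D \<Longrightarrow> f y = 0 \<Longrightarrow> {0} \<subseteq> convex_subdifferential D F y"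
    and V: "\<And>y \<rho>. y \<in> D \<Longrightarrow> V (y, \<rho>) = F y + ereal (1/2 * \<rho>\<^sup>2)"
    and f_deriv: "\<And>y. y \<in> D \<Longrightarrow> deriv f y \<noteq> 0"
    and x: "x \<in> D \<times> UNIV"
  shows
    "(\<forall>p \<in> D \<times> UNIV.
        interior D \<noteq> {} \<and>
        (fst p \<in> interior D \<or> 0 \<notin> symmetric_subdifferential f (fst p) \<or> f (fst p) = 0) \<longrightarrow>
        gradient_exists V (D \<times> UNIV) p)
     \<and>
     (x \<notin> A \<inter> B \<and> PA x \<notin> A \<inter> B \<and> PB (reflector PA x) \<notin> A \<inter> B \<and>
      \<not> collinear {x, PA x, PB (reflector PA x)} \<longrightarrow>
      (let c = circumcenter x (reflector PA x) (reflector PB (reflector PA x));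
           q = PB (reflector PA x);
           t = douglas_rachford PA PB x
       in \<exists>\<mu>1 \<mu>2 \<mu>3 :: real.
            (gradient_exists V (D \<times> UNIV) (PA x) \<longrightarrow>
               c = PA x - \<mu>1 *\<^sub>R gradient V (D \<times> UNIV) (PA x)) \<and>
            (gradient_exists V (D \<times> UNIV) q \<longrightarrow>
               c = q - \<mu>2 *\<^sub>R gradient V (D \<times> UNIV) q) \<and>
            (gradient_exists V (D \<times> UNIV) t \<longrightarrow>
               c = t - \<mu>3 *\<^sub>R gradient V (D \<times> UNIV) t)))
     \<and>
     (x \<notin> A \<inter> B \<and> PB x \<notin> A \<inter> B \<and> PA (reflector PB x) \<notin> A \<inter> B \<and>
      \<not> collinear {x, PB x, PA (reflector PB x)} \<longrightarrow>
      (let c = circumcenter x (reflector PB x) (reflector PA (reflector PB x));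
           q = PA (reflector PB x);
           t = douglas_rachford PB PA x
       in \<exists>\<mu>1 \<mu>2 \<mu>3 :: real.
            (gradient_exists V (D \<times> UNIV) (PB x) \<longrightarrow>
               c = PB x - \<mu>1 *\<^sub>R gradient V (D \<times> UNIV) (PB x)) \<and>
            (gradient_exists V (D \<times> UNIV) q \<longrightarrow>
               c = q - \<mu>2 *\<^sub>R gradient V (D \<times> UNIV) q) \<and>
            (gradient_exists V (D \<times> UNIV) t \<longrightarrow>
               c = t - \<mu>3 *\<^sub>R gradient V (D \<times> UNIV) t)))"
proof (intro conjI ballI impI)
  interpret newton_potential f D F
    using f_diff D(2) f_deriv F_subdiff F_subdiff_zero by unfold_locales
  have grad: "fst p \<in> D" "gradient V (D \<times> UNIV) p = (newton_step (fst p), snd p)"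
    if "gradient_exists V (D \<times> UNIV) p" for p
    using gradient_newton[OF V, of "fst p" "snd p"] that by simp_all
  \<comment> \<open>Off \<open>A \<inter> B\<close> the gradient at an axis point is horizontal and
    nonzero, so a suitable multiple leads to any other axis point.\<close>
  have axis_step: "\<exists>\<mu>. gradient_exists V (D \<times> UNIV) (a, 0) \<longrightarrow>
      (c, 0) = (a, 0) - \<mu> *\<^sub>R gradient V (D \<times> UNIV) (a, 0)" if "(a, 0) \<notin> A \<inter> B" for a c
  proof (cases "gradient_exists V (D \<times> UNIV) (a, 0)")
    case True
    have "f a \<noteq> 0" using that A B by auto
    moreover have "deriv f a \<noteq> 0" using grad(1)[OF True] f_deriv by simp
    ultimately have "newton_step a \<noteq> 0" by (simp add: newton_step_def)
    then show ?thesis using grad(2)[OF True]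
      by (intro exI[of _ "(a - c) / newton_step a"]) simp
  qed blast
  \<comment> \<open>The height \<open>r\<close> is arbitrary: a unit step cancels it and moves
    \<open>b\<close> to its Newton iterate. The graph point and the Douglas--Rachford point both lie
    over \<open>b\<close>.\<close>
  have graph_step: "gradient_exists V (D \<times> UNIV) (b, r) \<longrightarrow>
      (b - f b / deriv f b, 0) = (b, r) - 1 *\<^sub>R gradient V (D \<times> UNIV) (b, r)" for b r
    using grad(2) by (simp add: newton_step_def)
  obtain x1 x2 where x_eq: "x = (x1, x2)" by fastforce
  have PA_eq: "PA z = (fst z, 0)" for z
    using PA nearest_point_axis unfolding A by blast

  \<comment> \<open>Existence of the gradient\<close>
  show "gradient_exists V (D \<times> UNIV) p"
    if p_in: "p \<in> D \<times> UNIV" and ass: "interior D \<noteq> {} \<and>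
        (fst p \<in> interior D \<or> 0 \<notin> symmetric_subdifferential f (fst p) \<or> f (fst p) = 0)" for p
  proof -
    obtain y \<rho> where p: "p = (y, \<rho>)" "y \<in> D" using p_in by auto
    have sub: "newton_step y \<in> convex_subdifferential D F y"
      using ass p newton_step_subgradient_interior newton_step_subgradient_symmetric
        newton_step_subgradient_zero by auto
    \<comment> \<open>A singleton has empty interior; the second point of \<open>D\<close> is needed
      for uniqueness of the gradient.\<close>
    have "\<not> D \<subseteq> {y}"
      using ass interior_mono[of D "{y}"] by auto
    then obtain b where "b \<in> D" "b \<noteq> y" by blast
    then show ?thesis using gradient_exists_newton[OF V p(2) sub] p(1) by blast
  qed

  \<comment> \<open>Reflection first in the axis, then in the graph\<close>
  show "let c = circumcenter x (reflector PA x) (reflector PB (reflector PA x));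
           q = PB (reflector PA x);
           t = douglas_rachford PA PB x
       in \<exists>\<mu>1 \<mu>2 \<mu>3 :: real.
            (gradient_exists V (D \<times> UNIV) (PA x) \<longrightarrow>
               c = PA x - \<mu>1 *\<^sub>R gradient V (D \<times> UNIV) (PA x)) \<and>
            (gradient_exists V (D \<times> UNIV) q \<longrightarrow>
               c = q - \<mu>2 *\<^sub>R gradient V (D \<times> UNIV) q) \<and>
            (gradient_exists V (D \<times> UNIV) t \<longrightarrow>
               c = t - \<mu>3 *\<^sub>R gradient V (D \<times> UNIV) t)"
    if ass: "x \<notin> A \<inter> B \<and> PA x \<notin> A \<inter> B \<and> PB (reflector PA x) \<notin> A \<inter> B \<and>
      \<not> collinear {x, PA x, PB (reflector PA x)}"
  proof -
    have RA: "reflector PA x = (x1, - x2)"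
      by (simp add: reflector_def PA_eq x_eq)
    obtain b where b: "PB (x1, - x2) = (b, f b)" "x1 - b + (- x2 - f b) * deriv f b = 0"
      using nearest_point_graph[OF PB[unfolded B] f_diff, of "(x1, - x2)"] by auto
    \<comment> \<open>Otherwise \<open>x\<close> and \<open>PA x\<close> coincide.\<close>
    have "x2 \<noteq> 0" using ass by (auto simp: PA_eq x_eq)
    have "b \<noteq> x1"
    proof
      assume "b = x1"
      then have "collinear {x, PA x, PB (reflector PA x)}"
        unfolding RA b(1) unfolding PA_eq x_eq
        by (intro collinearI[of _ "(0, 1)"]) (auto simp: prod_eq_iff)
      then show False using ass by blast
    qed
    have RBA: "reflector PB (x1, - x2) = (2 * b - x1, 2 * f b + x2)"
      by (simp add: reflector_def b(1))
    have c: "circumcenter x (reflector PA x) (reflector PB (reflector PA x)) = (b - f b / deriv f b, 0)"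
      unfolding RA RBA unfolding x_eq
      using circumcenter_axis_graph[OF \<open>x2 \<noteq> 0\<close> \<open>b \<noteq> x1\<close> b(2)] .
    have t: "douglas_rachford PA PB x = (b, f b + x2)"
      unfolding douglas_rachford_def RA RBA unfolding x_eq by (simp add: field_simps)
    have PAx: "PA x = (x1, 0)" by (simp add: PA_eq x_eq)
    with ass obtain \<mu> where "gradient_exists V (D \<times> UNIV) (x1, 0) \<longrightarrow>
        (b - f b / deriv f b, 0) = (x1, 0) - \<mu> *\<^sub>R gradient V (D \<times> UNIV) (x1, 0)"
      using axis_step[of x1] by metis
    then show ?thesis
      unfolding Let_def c unfolding RA b(1) t PAx
      by (intro exI[of _ \<mu>] exI[of _ 1] conjI graph_step)
  qed

  \<comment> \<open>Reflection first in the graph, then in the axis\<close>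
  show "let c = circumcenter x (reflector PB x) (reflector PA (reflector PB x));
           q = PA (reflector PB x);
           t = douglas_rachford PB PA x
       in \<exists>\<mu>1 \<mu>2 \<mu>3 :: real.
            (gradient_exists V (D \<times> UNIV) (PB x) \<longrightarrow>
               c = PB x - \<mu>1 *\<^sub>R gradient V (D \<times> UNIV) (PB x)) \<and>
            (gradient_exists V (D \<times> UNIV) q \<longrightarrow>
               c = q - \<mu>2 *\<^sub>R gradient V (D \<times> UNIV) q) \<and>
            (gradient_exists V (D \<times> UNIV) t \<longrightarrow>
               c = t - \<mu>3 *\<^sub>R gradient V (D \<times> UNIV) t)"
    if ass: "x \<notin> A \<inter> B \<and> PB x \<notin> A \<inter> B \<and> PA (reflector PB x) \<notin> A \<inter> B \<and>
      \<not> collinear {x, PB x, PA (reflector PB x)}"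
  proof -
    obtain b where b: "PB x = (b, f b)" "x1 - b + (x2 - f b) * deriv f b = 0"
      using nearest_point_graph[OF PB[unfolded B] f_diff, of x] by (auto simp: x_eq)
    have RB: "reflector PB x = (2 * b - x1, 2 * f b - x2)"
      unfolding reflector_def b(1) unfolding x_eq by simp
    have q: "PA (reflector PB x) = (2 * b - x1, 0)" by (simp add: PA_eq RB)
    have RAB: "reflector PA (reflector PB x) = (2 * b - x1, x2 - 2 * f b)"
      unfolding reflector_def[of PA] q unfolding RB by simp
    have "b \<noteq> x1"
    proof
      assume "b = x1"
      then have "collinear {x, PB x, PA (reflector PB x)}"
        unfolding q b(1) unfolding x_eq
        by (intro collinearI[of _ "(0, 1)"]) (auto simp: prod_eq_iff)
      then show False using ass by blast
    qed
    \<comment> \<open>Otherwise the reflection of \<open>x\<close> already lies on the axis and is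
      its own projection there, with \<open>PB x\<close> as the midpoint between it and
      \<open>x\<close>.\<close>
    have "2 * f b - x2 \<noteq> 0"
    proof
      assume "2 * f b - x2 = 0"
      then have "collinear {x, PB x, PA (reflector PB x)}"
        unfolding q b(1) unfolding x_eq collinear_3_expand
        by (intro disjI2 exI[of _ "1/2"]) (simp add: field_simps)
      then show False using ass by blast
    qed
    have c: "circumcenter x (reflector PB x) (reflector PA (reflector PB x)) = (b - f b / deriv f b, 0)"
      unfolding RAB unfolding RB unfolding x_eq
      using circumcenter_graph_axis[OF \<open>b \<noteq> x1\<close> \<open>2 * f b - x2 \<noteq> 0\<close> b(2)] .
    have t: "douglas_rachford PB PA x = (b, x2 - f b)"
      unfolding douglas_rachford_def RAB unfolding x_eq by (simp add: field_simps)
    obtain \<mu> where "gradient_exists V (D \<times> UNIV) (2 * b - x1, 0) \<longrightarrow>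
        (b - f b / deriv f b, 0) = (2 * b - x1, 0) - \<mu> *\<^sub>R gradient V (D \<times> UNIV) (2 * b - x1, 0)"
      using axis_step[of "2 * b - x1"] ass unfolding q by metis
    then show ?thesis
      unfolding Let_def c unfolding q b(1) t
      by (intro exI[of _ 1] exI[of _ \<mu>] conjI graph_step)
  qed
qed

end
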